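(* Let $G$ be a nontrivial connected graph and let $\Gamma$ be a family of graphs such that $V(F)=V$ for every $F\in\Gamma$. Consider any function $h:E(G)\to\Gamma$. Then $G\otimes_h\Gamma$ is connected if and only if the intersection graph obtained from $\mathcal{F}(G,\Gamma,h)$ is connected.
   Context: All graphs are finite and simple. A graph is nontrivial if it has at least two vertices. Let $G$ be a graph, $\Gamma$ a family of graphs all having the same vertex set $V$, and $h:E(G)\to\Gamma$ a function. The product $G\otimes_h\Gamma$ is the graph with vertex set $V(G)\times V$ in which $(a,x)(b,y)$ is an edge if and only if $ab\in E(G)$ and $xy\in E(h(ab))$. The intersection graph obtained from a family of sets $\{S_i: i\in I\}$ is the graph with one vertex $v_i$ for each $i\in I$ and an edge $v_iv_j$ (for $i\ne j$) if and only if $S_i\cap S_j\neq\emptyset$. For each edge $ab\in E(G)$ and each connected component $C$ of $h(ab)$, define subsets $S_a(C),S_b(C)$ of $V(G)\times V$ as follows. If $C$ is bipartite with stable sets (bipartition classes) $V_1(C)$ and $V_2(C)$, then $$S_a(C)=(\{a\}\times V_1(C))\cup(\{b\}\times V_2(C)),\qquad S_b(C)=(\{a\}\times V_2(C))\cup(\{b\}\times V_1(C)).$$ (For a component consisting of a single vertex, one of the two stable sets is empty.) If $C$ is nonbipartite, then $S_a(C)=S_b(C)=\{a,b\}\times V(C)$. The family $\mathcal{F}(G,\Gamma,h)$ of subsets of $V(G)\times V$ is $$\mathcal{F}(G,\Gamma,h)=\bigcup_{a\in V(G),\ b\in N_G(a)}\{S_a(C): C \text{ is a component of } h(ab)\},$$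 where $N_G(a)$ is the set of neighbors of $a$ in $G$; thus for each edge $ab$ and each component $C$ of $h(ab)$ both $S_a(C)$ and $S_b(C)$ belong to the family. *)

theory Defs
  imports "Graph_Theory.Digraph_Component" "HOL-Library.FuncSet"
begin

text \<open>
  A finite simple graph is a \<^locale>\<open>pair_graph\<close>: a finite, loop-free, symmetric set of ordered pairs
  over a finite vertex set. The edge \<open>ab\<close> is thus represented by the two arcs \<open>(a, b)\<close> and \<open>(b, a)\<close>.
  So that a function on edges does not depend on the orientation, it takes the two-element
  set \<open>{a, b}\<close> as its argument.
\<close>

definition edges :: "'a pair_pre_digraph \<Rightarrow> 'a set set" where
  "edges G = {{a, b} | a b. (a, b) \<in> parcs G}"

definition neighbours :: "'a pair_pre_digraph \<Rightarrow> 'a \<Rightarrow> 'a set" where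
  "neighbours G a = {b. (a, b) \<in> parcs G}"

text \<open>\<open>V\<close> is the common vertex set of the graphs in the codomain of \<open>h\<close>.\<close>

definition graph_product ::
  "'a pair_pre_digraph \<Rightarrow> 'b set \<Rightarrow> ('a set \<Rightarrow> 'b pair_pre_digraph) \<Rightarrow> ('a \<times> 'b) pair_pre_digraph" where
  "graph_product G V h =
     \<lparr> pverts = pverts G \<times> V,
       parcs = {((a, x), (b, y)) | a x b y. (a, b) \<in> parcs G \<and> (x, y) \<in> parcs (h {a, b})} \<rparr>"

definition intersection_graph :: "'i set \<Rightarrow> ('i \<Rightarrow> 'c set) \<Rightarrow> 'i pair_pre_digraph" where
  "intersection_graph I S =
     \<lparr> pverts = I, parcs = {(i, j). i \<in> I \<and> j \<in> I \<and> i \<noteq> j \<and> S i \<inter> S j \<noteq> {}} \<rparr>"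

definition components :: "'b pair_pre_digraph \<Rightarrow> ('b, 'b \<times> 'b) pre_digraph set" where
  "components H = {C. pre_digraph.max_subgraph (with_proj H) connected C}"

definition stable_set :: "('b, 'e) pre_digraph \<Rightarrow> 'b set \<Rightarrow> bool" where
  "stable_set C X \<longleftrightarrow> X \<subseteq> verts C \<and> (\<forall>x\<in>X. \<forall>y\<in>X. \<not> x \<rightarrow>\<^bsub>C\<^esub> y)"

definition bipartition :: "('b, 'e) pre_digraph \<Rightarrow> 'b set \<Rightarrow> 'b set \<Rightarrow> bool" where
  "bipartition C X Y \<longleftrightarrow>
     stable_set C X \<and> stable_set C Y \<and> X \<union> Y = verts C \<and> X \<inter> Y = {}"

definition bipartite :: "('b, 'e) pre_digraph \<Rightarrow> bool" where
  "bipartite C \<longleftrightarrow> (\<exists>X Y. bipartition C X Y)"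

text \<open>
  The bipartition of a connected bipartite graph is unique up to the order of its two classes;
  the choice operator only fixes which class is called \<open>V\<^sub>1(C)\<close>. Exchanging the names exchanges
  \<open>S\<^sub>a(C)\<close> and \<open>S\<^sub>b(C)\<close>, so \<open>set_family\<close> below does not depend on this choice.
\<close>

definition stable_classes :: "('b, 'e) pre_digraph \<Rightarrow> 'b set \<times> 'b set" where
  "stable_classes C = (SOME (X, Y). bipartition C X Y)"

definition V1 :: "('b, 'e) pre_digraph \<Rightarrow> 'b set" where
  "V1 C = fst (stable_classes C)"

definition V2 :: "('b, 'e) pre_digraph \<Rightarrow> 'b set" where
  "V2 C = snd (stable_classes C)"

text \<open>
  \<open>S_set a b C\<close> is \<open>S\<^sub>a(C)\<close> for a component \<open>C\<close> of \<open>h(ab)\<close>; correspondingly \<open>S\<^sub>b(C)\<close> is \<open>S_set b a C\<close>.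
\<close>

definition S_set :: "'a \<Rightarrow> 'a \<Rightarrow> ('b, 'e) pre_digraph \<Rightarrow> ('a \<times> 'b) set" where
  "S_set a b C =
     (if bipartite C then ({a} \<times> V1 C) \<union> ({b} \<times> V2 C) else {a, b} \<times> verts C)"

definition set_family ::
  "'a pair_pre_digraph \<Rightarrow> ('a set \<Rightarrow> 'b pair_pre_digraph) \<Rightarrow> ('a \<times> 'b) set set" where
  "set_family G h =
     (\<Union>a \<in> pverts G. \<Union>b \<in> neighbours G a. {S_set a b C | C. C \<in> components (h {a, b})})"

end

theory Submission
  imports Defs
begin

text \<open>
  Every set of the family is nonempty and lies within one component of the product, and the family
  covers all vertices and all edges of the product. For any such family, walks in the product
  translate into walks in the intersection graph and conversely. That each \<open>S\<^sub>a(C)\<close> lies within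
  one component is a parity argument: a walk in \<open>C\<close> lifts to a walk in the product alternating
  between \<open>a\<close> and \<open>b\<close>, and if no vertex of \<open>C\<close> were reached with both parities, the parities would
  define a bipartition of \<open>C\<close>.
\<close>

section \<open>Connectedness and intersection graphs of covering families\<close>

lemma (in wf_digraph) connected_iff_rtrancl_symcl:
  "connected G \<longleftrightarrow>
     verts G \<noteq> {} \<and> (\<forall>u\<in>verts G. \<forall>v\<in>verts G. (u, v) \<in> ((arcs_ends G)\<^sup>s)\<^sup>*)"
proof -
  \<comment> \<open>Adjacency in a well-formed digraph never leaves the vertex set, so the
    restriction of \<open>rtrancl_on\<close> to \<open>verts G\<close> is automatic.\<close>
  have closed: "v \<in> verts G" if "(u, v) \<in> (arcs_ends G)\<^sup>s" for u v
    using that by (auto simp: symcl_def)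
  have "(u, v) \<in> rtrancl_on (verts G) ((arcs_ends G)\<^sup>s) \<longleftrightarrow> (u, v) \<in> ((arcs_ends G)\<^sup>s)\<^sup>*"
    if "u \<in> verts G" "v \<in> verts G" for u v
    using that closed by (blast intro: rtrancl_consistent_rtrancl_on dest: rtrancl_on_rtranclI)
  then show ?thesis
    unfolding connected_conv by blast
qed

lemma (in pair_sym_digraph) connected_iff_rtrancl:
  "connected (with_proj G) \<longleftrightarrow>
     pverts G \<noteq> {} \<and> (\<forall>u\<in>pverts G. \<forall>v\<in>pverts G. (u, v) \<in> (parcs G)\<^sup>*)"
proof -
  have "(parcs G)\<^sup>s = parcs G"
    using pair_sym_arcs by (auto simp: symcl_def symmetric_def dest: symD)
  then show ?thesis
    using connected_iff_rtrancl_symcl by simp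
qed

lemma pair_sym_digraph_intersection_graph: "pair_sym_digraph (intersection_graph I S)"
  by unfold_locales (auto simp: intersection_graph_def symmetric_def sym_def)

text \<open>Since \<open>F\<close> covers arcs, a walk in \<open>G\<close> is traced by a chain of
  sets that meet consecutively; since points of one set are joined in \<open>G\<close>, a chain of
  meeting sets is traced by a walk. \<open>nonempty\<close> and \<open>sub\<close> provide a vertex
  for each set, \<open>vertex\<close> a set for each vertex.\<close>

lemma (in pair_sym_digraph) connected_iff_connected_intersection_graph:
  assumes nonempty: "\<And>S. S \<in> F \<Longrightarrow> S \<noteq> {}"
    and sub: "\<And>S. S \<in> F \<Longrightarrow> S \<subseteq> pverts G"
    and vertex: "\<And>x. x \<in> pverts G \<Longrightarrow> \<exists>S\<in>F. x \<in> S"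
    and arc: "\<And>x y. (x, y) \<in> parcs G \<Longrightarrow> \<exists>S\<in>F. x \<in> S \<and> y \<in> S"
    and conn: "\<And>S x y. S \<in> F \<Longrightarrow> x \<in> S \<Longrightarrow> y \<in> S \<Longrightarrow> (x, y) \<in> (parcs G)\<^sup>*"
  shows "connected (with_proj G) \<longleftrightarrow>
         connected (with_proj (intersection_graph F (\<lambda>S. S)))"
proof -
  define J where "J = parcs (intersection_graph F (\<lambda>S. S))"
  have J: "(S, T) \<in> J \<longleftrightarrow> S \<in> F \<and> T \<in> F \<and> S \<noteq> T \<and> S \<inter> T \<noteq> {}" for S T
    by (simp add: J_def intersection_graph_def)
  \<comment> \<open>Intersection graphs have no loops, so the case \<open>S = T\<close> falls to
    reflexivity of the closure.\<close>
  have J': "(S, T) \<in> J\<^sup>*" if "S \<in> F" "T \<in> F" "x \<in> S" "x \<in> T" for S T x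
    using that J by (cases "S = T") auto
  have connected_J: "connected (with_proj (intersection_graph F (\<lambda>S. S))) \<longleftrightarrow>
      F \<noteq> {} \<and> (\<forall>S\<in>F. \<forall>T\<in>F. (S, T) \<in> J\<^sup>*)"
    using pair_sym_digraph.connected_iff_rtrancl[OF pair_sym_digraph_intersection_graph]
    by (simp add: J_def intersection_graph_def)
  \<comment> \<open>\<open>T\<close> is generalized so that the induction hypothesis applies to the
    set covering the last arc \<open>(y, z)\<close>; that set shares \<open>z\<close> with
    \<open>T\<close>.\<close>
  have to_J: "(S, T) \<in> J\<^sup>*"
    if "(x, y) \<in> (parcs G)\<^sup>*" "S \<in> F" "T \<in> F" "x \<in> S" "y \<in> T" for x y S T
    using that(1,3,5)
  proof (induction arbitrary: T rule: rtrancl_induct)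
    case base
    then show ?case using J' that by blast
  next
    case (step y z)
    then show ?case using arc J' by (meson rtrancl_trans)
  qed
  \<comment> \<open>The end point is generalized so that the induction hypothesis applies to a point
    common to the last two sets, from which \<open>conn\<close> leads on.\<close>
  have from_J: "(x, y) \<in> (parcs G)\<^sup>*"
    if "(S, T) \<in> J\<^sup>*" "S \<in> F" "x \<in> S" "y \<in> T" for x y S T
    using that(1,4)
  proof (induction arbitrary: y rule: rtrancl_induct)
    case base
    then show ?case using conn that by blast
  next
    case (step T U)
    then obtain z where "z \<in> T" "z \<in> U" "U \<in> F"
      using J by blast
    then show ?case using step conn by (meson rtrancl_trans)
  qed
  show ?thesis
    unfolding connected_J connected_iff_rtrancl
  proof (intro iffI conjI ballI)
    fix S T
    assume "pverts G \<noteq> {} \<and> (\<forall>u\<in>pverts G. \<forall>v\<in>pverts G. (u, v) \<in> (parcs G)\<^sup>*)" "S \<in> F" "T \<in> F"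
    then show "(S, T) \<in> J\<^sup>*"
      using nonempty sub to_J by (metis all_not_in_conv subsetD)
  next
    fix x y
    assume "F \<noteq> {} \<and> (\<forall>S\<in>F. \<forall>T\<in>F. (S, T) \<in> J\<^sup>*)" "x \<in> pverts G" "y \<in> pverts G"
    then show "(x, y) \<in> (parcs G)\<^sup>*"
      using vertex from_J by meson
  qed (use nonempty sub vertex in blast)+
qed

section \<open>Components of a symmetric graph\<close>

lemma componentsD:
  assumes "C \<in> components H"
  shows "wf_digraph C" "connected C" "verts C \<subseteq> pverts H" "arcs_ends C \<subseteq> parcs H"
proof -
  have sub: "subgraph C (with_proj H)" and "connected C"
    using assms by (auto simp: components_def pre_digraph.max_subgraph_def)
  then show "wf_digraph C" "connected C" "verts C \<subseteq> pverts H" "arcs_ends C \<subseteq> parcs H"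
    using pre_digraph.adj_mono[where H = C and G = "with_proj H"]
    by (auto simp: subgraph_def)
qed

text \<open>With symmetric arcs, the vertices reachable from \<open>x\<close> induce a strongly
  connected component, and this is a maximal connected subgraph as \<open>components\<close>
  demands. Being induced, it contains every arc leaving \<open>x\<close>.\<close>

lemma (in pair_sym_digraph) component_containing:
  assumes "x \<in> pverts G"
  obtains C where "C \<in> components G" "x \<in> verts C"
    "\<And>y. (x, y) \<in> parcs G \<Longrightarrow> (x, y) \<in> arcs_ends C"
proof -
  define W where "W = {y. x \<rightarrow>\<^sup>*\<^bsub>with_proj G\<^esub> y}"
  define C where "C = with_proj G \<restriction> W"
  have sym: "symmetric (with_proj G)"
    by (rule pair_sym_arcs)
  have "C \<in> sccs"
    unfolding C_def W_def using assms by (rule induce_reachable_is_in_sccs)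
  then have ind: "induced_subgraph C (with_proj G)" and sc: "strongly_connected C"
    by (auto simp: sccs_def)
  then interpret C: wf_digraph C
    by (blast intro: wf_digraphI_induced)
  have sub: "subgraph C (with_proj G)"
    using ind by (rule induced_imp_subgraph)
  have x: "x \<in> W"
    using assms by (simp add: W_def)
  have conn: "connected C"
    using sc C.reachable_mk_symmetricI unfolding connected_def strongly_connected_def by auto
  \<comment> \<open>A connected \<open>H\<close> above \<open>C\<close> contains \<open>x\<close>,
    so its vertices are reachable from \<open>x\<close> and lie in \<open>W\<close>; its arcs then
    belong to the induced subgraph.\<close>
  have maximal: "H = C" if "subgraph C H" "subgraph H (with_proj G)" "connected H" for H
  proof -
    have verts: "verts C \<subseteq> verts H" "arcs C \<subseteq> arcs H" "arcs H \<subseteq> parcs G"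
        "tail C = tail H" "head C = head H" "wf_digraph H"
      using that by (auto simp: subgraph_def compatible_def)
    have "y \<in> W" if "y \<in> verts H" for y
    proof -
      have "x \<rightarrow>\<^sup>*\<^bsub>mk_symmetric H\<^esub> y"
        using \<open>connected H\<close> that verts x
        by (auto simp: connected_def strongly_connected_def C_def)
      then have "x \<rightarrow>\<^sup>*\<^bsub>mk_symmetric G\<^esub> y"
        using subgraph_mk_symmetric[OF \<open>subgraph H (with_proj G)\<close>] pre_digraph.reachable_mono
        by fast
      then show ?thesis
        using reachable_mk_symmetric_eq[OF sym] by (simp add: W_def)
    qed
    then have "verts H = verts C"
      using verts by (auto simp: C_def)
    moreover have "arcs H = arcs C"
    proof
      show "arcs H \<subseteq> arcs C"
      proof
        fix e
        assume "e \<in> arcs H"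
        then have "e \<in> parcs G" "tail H e \<in> verts C" "head H e \<in> verts C"
          using verts \<open>verts H = verts C\<close> wf_digraph.wellformed[OF \<open>wf_digraph H\<close>] by auto
        then show "e \<in> arcs C"
          using verts(4,5)[symmetric] by (simp add: C_def)
      qed
    qed (fact verts)
    ultimately show ?thesis
      using verts by (simp add: pre_digraph.equality)
  qed
  have "C \<in> components G"
    unfolding components_def using sub conn maximal by (auto intro!: max_subgraphI)
  moreover have "(x, y) \<in> arcs_ends C" if "(x, y) \<in> parcs G" for y
    using that x reachable_adj_trans[of x x y] assms
    by (auto simp: C_def W_def arcs_ends_conv in_arcsD2 intro!: rev_image_eqI)
  ultimately show ?thesis
    using that x by (simp add: C_def)
qed

section \<open>Bipartitions and the parity of walks\<close>

lemma bipartition_V1_V2: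
  assumes "bipartite C"
  shows "bipartition C (V1 C) (V2 C)"
proof -
  have "\<exists>p. case p of (X, Y) \<Rightarrow> bipartition C X Y"
    using assms by (auto simp: bipartite_def)
  then have "case stable_classes C of (X, Y) \<Rightarrow> bipartition C X Y"
    unfolding stable_classes_def by (rule someI_ex)
  then show ?thesis
    by (simp add: V1_def V2_def case_prod_unfold)
qed

lemma bipartition_arcs_ends:
  assumes "bipartition C X Y" "(x, y) \<in> (arcs_ends C)\<^sup>s" "x \<in> verts C" "y \<in> verts C"
  shows "x \<in> X \<longleftrightarrow> y \<notin> X"
proof -
  have "x \<rightarrow>\<^bsub>C\<^esub> y \<or> y \<rightarrow>\<^bsub>C\<^esub> x"
    using assms(2) by (auto simp: symcl_def)
  moreover have "Z = X \<or> Z = Y \<Longrightarrow> u \<in> Z \<Longrightarrow> v \<in> Z \<Longrightarrow> \<not> u \<rightarrow>\<^bsub>C\<^esub> v" for Z u v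
    using assms(1) by (auto simp: bipartition_def stable_set_def)
  moreover have "x \<in> X \<longleftrightarrow> x \<notin> Y" "y \<in> X \<longleftrightarrow> y \<notin> Y"
    using assms by (auto simp: bipartition_def)
  ultimately show ?thesis by metis
qed

text \<open>This is the bipartite double cover, the product of \<open>E\<close> with a single edge.
  The Boolean records the parity of a walk and later encodes the choice between \<open>a\<close> and
  \<open>b\<close>.\<close>

definition double_cover :: "('b \<times> 'b) set \<Rightarrow> ((bool \<times> 'b) \<times> (bool \<times> 'b)) set" where
  "double_cover E = {((s, x), (\<not> s, y)) | s x y. (x, y) \<in> E}"

lemma double_cover_lift:
  assumes "(x, y) \<in> E\<^sup>*"
  obtains t where "((s, x), (t, y)) \<in> (double_cover E)\<^sup>*"
proof -
  have "\<exists>t. ((s, x), (t, y)) \<in> (double_cover E)\<^sup>*"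
    using assms
  proof (induction rule: rtrancl_induct)
    case (step y z)
    then obtain t where "((s, x), (t, y)) \<in> (double_cover E)\<^sup>*" by blast
    moreover have "((t, y), (\<not> t, z)) \<in> double_cover E"
      using step by (simp add: double_cover_def)
    ultimately show ?case by (blast intro: rtrancl_into_rtrancl)
  qed blast
  then show ?thesis using that by blast
qed

lemma rtrancl_map:
  assumes "\<And>x y. (x, y) \<in> r \<Longrightarrow> (f x, f y) \<in> s" and "(x, y) \<in> r\<^sup>*"
  shows "(f x, f y) \<in> s\<^sup>*"
  using assms(2) by (induction rule: rtrancl_induct) (auto intro: assms(1) rtrancl_into_rtrancl)

text \<open>Negating the Boolean is an automorphism of the double cover.\<close>

lemma double_cover_swap:
  assumes "((s, x), (t, y)) \<in> (double_cover E)\<^sup>*"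
  shows "((\<not> s, x), (\<not> t, y)) \<in> (double_cover E)\<^sup>*"
proof -
  have "(map_prod Not id p, map_prod Not id q) \<in> double_cover E" if "(p, q) \<in> double_cover E" for p q
    using that by (auto simp: double_cover_def)
  from rtrancl_map[of "double_cover E" "map_prod Not id", OF this assms] show ?thesis by simp
qed

lemma sym_double_cover: "sym E \<Longrightarrow> sym (double_cover E)"
  by (auto simp: double_cover_def sym_def)

lemma sym_symcl: "sym (E\<^sup>s)"
  by (auto simp: symcl_def sym_def)

text \<open>Each arc flips both the Boolean and membership in \<open>X\<close>, so whether the two
  agree is invariant along walks. The lift of any walk from \<open>x\<close> to \<open>y\<close>
  must therefore end at level \<open>t\<close>.\<close>

lemma (in wf_digraph) double_cover_bipartite:
  assumes "connected G" "bipartition G X Y" "x \<in> verts G" "y \<in> verts G"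
    and "s \<longleftrightarrow> x \<in> X" "t \<longleftrightarrow> y \<in> X"
  shows "((s, x), (t, y)) \<in> (double_cover ((arcs_ends G)\<^sup>s))\<^sup>*"
proof -
  have "(x, y) \<in> ((arcs_ends G)\<^sup>s)\<^sup>*"
    using assms connected_iff_rtrancl_symcl by blast
  then obtain t' where t': "((s, x), (t', y)) \<in> (double_cover ((arcs_ends G)\<^sup>s))\<^sup>*"
    by (rule double_cover_lift)
  have step: "(s \<longleftrightarrow> x \<in> X) \<longleftrightarrow> (t \<longleftrightarrow> y \<in> X)"
    if "((s, x), (t, y)) \<in> double_cover ((arcs_ends G)\<^sup>s)" for s t x y
  proof -
    have "(x, y) \<in> (arcs_ends G)\<^sup>s" "t \<longleftrightarrow> \<not> s"
      using that by (auto simp: double_cover_def)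
    moreover from this have "x \<in> verts G" "y \<in> verts G"
      by (auto simp: symcl_def)
    ultimately show ?thesis
      using bipartition_arcs_ends[OF assms(2)] by blast
  qed
  have "(s \<longleftrightarrow> x \<in> X) \<longleftrightarrow> (t' \<longleftrightarrow> y \<in> X)"
    using t' by (induction rule: rtrancl_induct2) (use step in blast)+
  then show ?thesis
    using assms t' by simp
qed

text \<open>Some vertex \<open>z\<close> is reached with both parities, since otherwise the parities
  would give a bipartition. A detour through \<open>z\<close> then corrects the parity of any
  walk.\<close>

lemma (in wf_digraph) double_cover_not_bipartite:
  assumes "connected G" "\<not> bipartite G" "x \<in> verts G" "y \<in> verts G"
  shows "((s, x), (t, y)) \<in> (double_cover ((arcs_ends G)\<^sup>s))\<^sup>*"
proof -
  define L where "L = double_cover ((arcs_ends G)\<^sup>s)"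
  have lift: "\<exists>t. ((s, u), (t, v)) \<in> L\<^sup>*" if "u \<in> verts G" "v \<in> verts G" for s u v
    using assms(1) that double_cover_lift unfolding connected_iff_rtrancl_symcl L_def by metis
  have swap: "((\<not> s, u), (\<not> t, v)) \<in> L\<^sup>*" if "((s, u), (t, v)) \<in> L\<^sup>*" for s u t v
    using that unfolding L_def by (rule double_cover_swap)
  have sym: "(q, p) \<in> L\<^sup>*" if "(p, q) \<in> L\<^sup>*" for p q
    using that sym_rtrancl[OF sym_double_cover[OF sym_symcl]] unfolding L_def by (rule symD[rotated])
  have adj: "((s, u), (\<not> s, v)) \<in> L" if "(u, v) \<in> arcs_ends G" for s u v
    using that by (simp add: L_def double_cover_def symcl_def)
  \<comment> \<open>\<open>X t\<close> holds the vertices reached at level \<open>t\<close> from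
    \<open>x\<close> at level \<open>True\<close>. Arcs lead from \<open>X t\<close> to
    \<open>X (\<not> t)\<close>, so if the two classes were disjoint, both would be stable.\<close>
  define X where "X t = {v \<in> verts G. ((True, x), (t, v)) \<in> L\<^sup>*}" for t
  have next_class: "v \<in> X (\<not> t)" if "u \<in> X t" "(u, v) \<in> arcs_ends G" for u v t
    using that adj[of u v t] by (auto simp: X_def intro: rtrancl_into_rtrancl)
  have "X True \<union> X False = verts G"
    using lift[OF assms(3)] by (auto simp: X_def) (metis (full_types))
  moreover have "stable_set G (X t)" if "X True \<inter> X False = {}" for t
  proof -
    have "X t \<subseteq> verts G" "X t \<inter> X (\<not> t) = {}"
      using that by (cases t; auto simp: X_def)+
    then show ?thesis
      using next_class[of _ t] unfolding stable_set_def by blast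
  qed
  ultimately have "X True \<inter> X False \<noteq> {}"
    using assms(2) unfolding bipartite_def bipartition_def by blast
  \<comment> \<open>The walk from \<open>(True, x)\<close> to \<open>(True, z)\<close> is reversed
    and followed by the one to \<open>(False, z)\<close>.\<close>
  then obtain z where z: "z \<in> verts G" "((True, z), (False, z)) \<in> L\<^sup>*"
    unfolding X_def using sym by (blast intro: rtrancl_trans)
  have both: "((s, z), (t, z)) \<in> L\<^sup>*" for s t
    using z(2) swap[OF z(2)] by (cases s; cases t) auto
  \<comment> \<open>The lifts end above \<open>z\<close> at levels that may differ;
    \<open>both\<close> bridges them.\<close>
  obtain s' t' where "((s, x), (s', z)) \<in> L\<^sup>*" "((t, y), (t', z)) \<in> L\<^sup>*"
    using lift assms z(1) by meson
  then show ?thesis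
    unfolding L_def[symmetric] using both sym by (meson rtrancl_trans)
qed

section \<open>The sets of the family: connectivity and covering\<close>

lemma set_familyE:
  assumes "S \<in> set_family G h"
  obtains a b C where "(a, b) \<in> parcs G" "C \<in> components (h {a, b})" "S = S_set a b C"
  using assms by (auto simp: set_family_def neighbours_def)

lemma (in pair_sym_digraph) S_set_in_set_family:
  assumes "(a, b) \<in> parcs G" "C \<in> components (h {a, b})"
  shows "S_set a b C \<in> set_family G h" "S_set b a C \<in> set_family G h"
proof -
  have "(b, a) \<in> parcs G"
    using assms pair_sym_arcs by (auto simp: symmetric_def dest: symD)
  then show "S_set a b C \<in> set_family G h" "S_set b a C \<in> set_family G h"
    using assms in_arcsD1 unfolding set_family_def neighbours_def
    by (fastforce simp: insert_commute)+
qed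

lemma S_set_rtrancl:
  fixes C :: "('b, 'e) pre_digraph"
  assumes C: "wf_digraph C" "connected C"
    and adj: "\<And>x y. (x, y) \<in> (arcs_ends C)\<^sup>s \<Longrightarrow> ((a, x), (b, y)) \<in> R \<and> ((b, x), (a, y)) \<in> R"
    and "p \<in> S_set a b C" "q \<in> S_set a b C"
  shows "(p, q) \<in> R\<^sup>*"
proof -
  interpret wf_digraph C by fact
  define f where "f = (\<lambda>(s, x :: 'b). (if s then a else b, x))"
  have lift: "(f u, f v) \<in> R\<^sup>*" if "(u, v) \<in> (double_cover ((arcs_ends C)\<^sup>s))\<^sup>*" for u v
    using _ that by (rule rtrancl_map) (use adj in \<open>auto simp: double_cover_def f_def\<close>)
  show ?thesis
  proof (cases "bipartite C")
    case True
    note bip = bipartition_V1_V2[OF True]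
    have "\<exists>s x. p = f (s, x) \<and> x \<in> verts C \<and> (s \<longleftrightarrow> x \<in> V1 C)" if "p \<in> S_set a b C" for p
    \<comment> \<open>The test singles out \<open>{a} \<times> V1 C\<close>; every other point of
      the set lies in \<open>{b} \<times> V2 C\<close> and takes the Boolean
      \<open>False\<close>.\<close>
    proof (cases "snd p \<in> V1 C \<and> fst p = a")
      case True
      with bip show ?thesis
        by (intro exI[of _ True] exI[of _ "snd p"]) (auto simp: f_def bipartition_def prod_eq_iff)
    next
      case False
      with bip that \<open>bipartite C\<close> show ?thesis
        by (intro exI[of _ False] exI[of _ "snd p"]) (auto simp: f_def S_set_def bipartition_def)
    qed
    then obtain s x t y where "p = f (s, x)" "x \<in> verts C" "s \<longleftrightarrow> x \<in> V1 C"
      "q = f (t, y)" "y \<in> verts C" "t \<longleftrightarrow> y \<in> V1 C"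
      using assms(4,5) by metis
    then show ?thesis
      using lift[OF double_cover_bipartite[OF C(2) bip]] by blast
  next
    case False
    have "\<exists>s x. p = f (s, x) \<and> x \<in> verts C" if "p \<in> S_set a b C" for p
      using that False by (auto simp: S_set_def f_def)
    then show ?thesis
      using lift[OF double_cover_not_bipartite[OF C(2) False]] assms(4,5) by metis
  qed
qed

text \<open>If \<open>C\<close> is bipartite, the ends of the arc lie in different classes:
  \<open>x\<close> in \<open>V1 C\<close> gives the first alternative, \<open>x\<close> in
  \<open>V2 C\<close> the second.\<close>

lemma mem_S_set_arc:
  assumes "wf_digraph C" "(x, y) \<in> arcs_ends C"
  shows "(a, x) \<in> S_set a b C \<and> (b, y) \<in> S_set a b C \<or>
         (a, x) \<in> S_set b a C \<and> (b, y) \<in> S_set b a C"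
proof -
  have xy: "x \<in> verts C" "y \<in> verts C"
    using assms by (auto simp: wf_digraph.adj_in_verts)
  show ?thesis
  proof (cases "bipartite C")
    case True
    then show ?thesis
      using bipartition_V1_V2[OF True] bipartition_arcs_ends[of C "V1 C" "V2 C" x y] assms xy
      by (auto simp: S_set_def symcl_def bipartition_def)
  qed (use xy in \<open>auto simp: S_set_def\<close>)
qed

lemma mem_S_set_vertex:
  assumes "x \<in> verts C"
  shows "(a, x) \<in> S_set a b C \<or> (a, x) \<in> S_set b a C"
  using assms bipartition_V1_V2[of C] by (auto simp: S_set_def bipartition_def)

lemma S_set_nonempty: "verts C \<noteq> {} \<Longrightarrow> S_set a b C \<noteq> {}"
  using bipartition_V1_V2[of C] by (auto simp: S_set_def bipartition_def)

lemma S_set_subset: "S_set a b C \<subseteq> {a, b} \<times> verts C"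
  using bipartition_V1_V2[of C] by (auto simp: S_set_def bipartition_def)

section \<open>The product graph and its covering by the family\<close>

theorem theorem2p6:
  fixes G :: "'a pair_pre_digraph"
    and \<Gamma> :: "'b pair_pre_digraph set"
    and V :: "'b set"
    and h :: "'a set \<Rightarrow> 'b pair_pre_digraph"
  assumes "pair_graph G"
    and "card (pverts G) \<ge> 2"
    and "connected (with_proj G)"
    and "\<And>F. F \<in> \<Gamma> \<Longrightarrow> pair_graph F"
    and "\<And>F. F \<in> \<Gamma> \<Longrightarrow> pverts F = V"
    and "h \<in> edges G \<rightarrow> \<Gamma>"
  shows "connected (with_proj (graph_product G V h)) \<longleftrightarrow>
         connected (with_proj (intersection_graph (set_family G h) (\<lambda>S. S)))"
proof -
  interpret G: pair_graph G by fact
  define P where "P = graph_product G V h"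
  have pverts_P: "pverts P = pverts G \<times> V"
    by (simp add: P_def graph_product_def)
  have parcs_P: "((a, x), (b, y)) \<in> parcs P \<longleftrightarrow> (a, b) \<in> parcs G \<and> (x, y) \<in> parcs (h {a, b})"
    for a b x y
    by (auto simp: P_def graph_product_def)
  have factor: "pair_graph (h {a, b})" "pverts (h {a, b}) = V" if "(a, b) \<in> parcs G" for a b
  proof -
    have "h {a, b} \<in> \<Gamma>"
      using assms(6) that by (auto simp: edges_def)
    then show "pair_graph (h {a, b})" "pverts (h {a, b}) = V"
      using assms by auto
  qed
  have factor_sym: "pair_sym_digraph (h {a, b})" if "(a, b) \<in> parcs G" for a b
    using factor(1)[OF that] by (simp add: pair_graph_def pair_pseudo_graph_def)
  have swap_G: "(b, a) \<in> parcs G" if "(a, b) \<in> parcs G" for a b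
    using that G.pair_sym_arcs by (auto simp: symmetric_def dest: symD)
  have swap_h: "(y, x) \<in> parcs (h {a, b})"
    if "(a, b) \<in> parcs G" "(x, y) \<in> parcs (h {a, b})" for a b x y
    using that pair_sym_digraph.pair_sym_arcs[OF factor_sym]
    by (auto simp: symmetric_def dest: symD)
  interpret P: pair_sym_digraph P
  proof
    show "fst e \<in> pverts P" "snd e \<in> pverts P" if "e \<in> parcs P" for e
    proof -
      obtain a x b y where e: "e = ((a, x), (b, y))"
        by (metis surj_pair)
      then have ab: "(a, b) \<in> parcs G" and xy: "(x, y) \<in> parcs (h {a, b})"
        using that parcs_P by auto
      interpret H: pair_graph "h {a, b}"
        using factor(1)[OF ab] .
      show "fst e \<in> pverts P" "snd e \<in> pverts P"
        using e ab xy factor(2)[OF ab] G.in_arcsD1 G.in_arcsD2 H.in_arcsD1 H.in_arcsD2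
        by (auto simp: pverts_P)
    qed
    \<comment> \<open>Reversing an arc keeps the same factor, because \<open>h\<close> is applied to
      the unordered pair.\<close>
    show "symmetric (with_proj P)"
      using swap_G swap_h by (auto simp: symmetric_def sym_def parcs_P insert_commute)
  qed
  \<comment> \<open>Nontriviality and connectedness of \<open>G\<close> enter here: the first arc of
    a walk from \<open>a\<close> to another vertex gives the edge \<open>ab\<close> through which
    \<open>(a, x)\<close> is covered.\<close>
  have neighbour: "\<exists>b. (a, b) \<in> parcs G" if "a \<in> pverts G" for a
  proof -
    have "\<not> pverts G \<subseteq> {a}"
      using assms(2) card_mono[of "{a}" "pverts G"] by auto
    then obtain c where "c \<in> pverts G" "c \<noteq> a" by blast
    moreover from this have "(a, c) \<in> (parcs G)\<^sup>*"
      using assms(3) that G.connected_iff_rtrancl by blast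
    ultimately show ?thesis by (metis converse_rtranclE)
  qed
  show ?thesis
    unfolding P_def[symmetric]
  proof (rule P.connected_iff_connected_intersection_graph)
    fix S
    assume "S \<in> set_family G h"
    then obtain a b C where ab: "(a, b) \<in> parcs G" and C: "C \<in> components (h {a, b})"
      and S: "S = S_set a b C"
      by (rule set_familyE)
    note C' = componentsD[OF C]
    interpret C: wf_digraph C by fact
    have "verts C \<noteq> {}"
      using C'(2) C.connected_iff_rtrancl_symcl by blast
    then show "S \<noteq> {}"
      unfolding S by (rule S_set_nonempty)
    show "S \<subseteq> pverts P"
      using S_set_subset[of a b C] C'(3) factor(2)[OF ab] G.in_arcsD1[OF ab] G.in_arcsD2[OF ab]
      unfolding S pverts_P by blast
    fix p q
    assume "p \<in> S" "q \<in> S"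
    \<comment> \<open>An edge of \<open>C\<close> yields two crossing edges of the product, as the
      alternation between \<open>a\<close> and \<open>b\<close> in \<open>S_set_rtrancl\<close>
      requires.\<close>
    moreover have "((a, x), (b, y)) \<in> parcs P \<and> ((b, x), (a, y)) \<in> parcs P"
      if "(x, y) \<in> (arcs_ends C)\<^sup>s" for x y
    proof -
      have "(x, y) \<in> parcs (h {a, b})"
        using that C'(4) swap_h[OF ab] by (auto simp: symcl_def)
      then show ?thesis
        using ab swap_G[OF ab] by (simp add: parcs_P insert_commute)
    qed
    ultimately show "(p, q) \<in> (parcs P)\<^sup>*"
      unfolding S by (intro S_set_rtrancl[OF C'(1,2)])
  next
    fix p
    assume "p \<in> pverts P"
    then obtain a x where p: "p = (a, x)" "a \<in> pverts G" "x \<in> V"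
      by (auto simp: pverts_P)
    then obtain b where ab: "(a, b) \<in> parcs G"
      using neighbour by blast
    then obtain C where "C \<in> components (h {a, b})" "x \<in> verts C"
      using pair_sym_digraph.component_containing[OF factor_sym] factor(2) p(3) by metis
    then show "\<exists>S\<in>set_family G h. p \<in> S"
      using G.S_set_in_set_family[OF ab] mem_S_set_vertex p(1) by metis
  next
    fix p q
    assume "(p, q) \<in> parcs P"
    moreover obtain a x b y where pq: "p = (a, x)" "q = (b, y)"
      by (metis surj_pair)
    ultimately have ab: "(a, b) \<in> parcs G" and xy: "(x, y) \<in> parcs (h {a, b})"
      by (auto simp: parcs_P)
    have "x \<in> pverts (h {a, b})"
      using factor_sym[OF ab] xy by (auto simp: pair_sym_digraph_def dest: pair_wf_digraph.in_arcsD1)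
    \<comment> \<open>The component must contain the arc itself, so that in the bipartite case
      \<open>x\<close> and \<open>y\<close> fall into opposite classes.\<close>
    then obtain C where "C \<in> components (h {a, b})" "(x, y) \<in> arcs_ends C"
      using pair_sym_digraph.component_containing[OF factor_sym[OF ab]] xy by metis
    then show "\<exists>S\<in>set_family G h. p \<in> S \<and> q \<in> S"
      using G.S_set_in_set_family[OF ab] mem_S_set_arc[of C x y a b] componentsD(1) pq by metis
  qed
qed

end
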